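(* Let $\alpha\in\mathbb{C}$, $a_1,b_1\in\mathbb{C}^*$ and $t=q^\tau$ satisfy $|qa_1^{-1}b_1^{-1}|<|q^{\alpha}t^{2i-2}|<1$ for $i=1,\ldots,n$. Suppose $\tau\notin\mathbb{Z}_+=\{1,2,\ldots\}$. Let $x=(x_1,\ldots,x_n)\in(\mathbb{C}^* )^n$ be such that no point of the lattice $\{(x_1q^{\nu_1},\ldots,x_nq^{\nu_n}):\nu\in\mathbb{Z}^n\}$ is a pole of $\Phi$. If $x_i=x_j$ for some $i$ and $j$ with $1\le i<j\le n$, then $I(x_1,x_2,\ldots,x_n)=0$.
   Context: Fix $0<q<1$ and an integer $n\ge1$. Put $(a)_\infty=\prod_{i\ge0}(1-q^ia)$, $t=q^\tau$, $$\Phi(z)=\prod_{i=1}^nz_i^\alpha\frac{(qa_1^{-1}z_i)_\infty}{(b_1z_i)_\infty}\prod_{1\le j<k\le n}z_j^{2\tau-1}\frac{(qt^{-1}z_k/z_j)_\infty}{(tz_k/z_j)_\infty},\qquad \Delta(z)=\prod_{1\le i<j\le n}(z_i-z_j),$$ and $I(x)=(1-q)^n\sum_{\nu\in\mathbb{Z}^n}\Phi(xq^\nu)\Delta(xq^\nu)$ with $xq^\nu=(x_1q^{\nu_1},\ldots,x_nq^{\nu_n})$, which converges absolutely under the stated conditions. Complex powers: fix a logarithm of each $x_i$ (equal variables getting equal logarithms) and set $(x_iq^\nu)^s=x_i^sq^{s\nu}$. Since $\tau$ is determined by $t$ only modulo $2\pi\sqrt{-1}/\log q$, the condition $\tau\notin\mathbb{Z}_+$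 is understood as $t\ne q^m$ for every $m\in\mathbb{Z}_+$. *)

theory Defs
  imports "HOL-Analysis.Analysis"
begin

text \<open>
  The index set \<open>{1,\<dots>,n}\<close> is an arbitrary finite linearly ordered type \<open>'n\<close>, with \<open>n = CARD('n)\<close>.
\<close>

definition qpoch_inf :: "real \<Rightarrow> complex \<Rightarrow> complex" where
  "qpoch_inf q a = prodinf (\<lambda>i. 1 - of_real q ^ i * a)"

text \<open>
  Because of the complex powers, \<open>\<Phi>\<close> is multivalued on \<open>(\<complex>\<^sup>*)\<^sup>n\<close>. We make it single valued
  by using logarithmic coordinates \<open>w\<close>, i.e. \<open>z\<^sub>i = exp w\<^sub>i\<close> and \<open>z\<^sub>i\<^sup>s = exp (s w\<^sub>i)\<close>.
  \<open>Phi_formula\<close> is the bare formula, meaningful on \<open>Phi_dom\<close>, where no denominator vanishes.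
\<close>

definition Phi_formula ::
  "real \<Rightarrow> complex \<Rightarrow> complex \<Rightarrow> complex \<Rightarrow> complex \<Rightarrow> complex ^ 'n::{finite,linorder} \<Rightarrow> complex"
where
  "Phi_formula q \<alpha> \<tau> a b w =
    (let t = of_real q powr \<tau>; z = (\<lambda>i. exp (w $ i)) in
      (\<Prod>i\<in>UNIV. exp (\<alpha> * w $ i) * (qpoch_inf q (of_real q * inverse a * z i) / qpoch_inf q (b * z i))) *
      (\<Prod>(j, k)\<in>{(j, k). j < k}. exp ((2 * \<tau> - 1) * w $ j) *
        (qpoch_inf q (of_real q * inverse t * (z k / z j)) / qpoch_inf q (t * (z k / z j)))))"

definition Phi_dom ::
  "real \<Rightarrow> complex \<Rightarrow> complex \<Rightarrow> (complex ^ 'n::{finite,linorder}) set"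
where
  "Phi_dom q \<tau> b =
    {w. (\<forall>i. qpoch_inf q (b * exp (w $ i)) \<noteq> 0) \<and>
        (\<forall>j k. j < k \<longrightarrow> qpoch_inf q (of_real q powr \<tau> * (exp (w $ k) / exp (w $ j))) \<noteq> 0)}"

text \<open>
  \<open>Phi_dom\<close> is open and dense, and a zero of a denominator may be cancelled by a numerator
  (e.g. when \<open>t\<^sup>2\<close> is a power of \<open>q\<close>). As a meromorphic function, \<open>\<Phi>\<close> is therefore the extension
  of the formula to its removable singularities, and its poles are the points at which
  the formula, restricted to \<open>Phi_dom\<close>, has no finite limit (in particular, points of indeterminacy
  count as poles). On \<open>Phi_dom\<close> itself the limit is the value of the formula, by continuity.
\<close>

definition Phi ::
  "real \<Rightarrow> complex \<Rightarrow> complex \<Rightarrow> complex \<Rightarrow> complex \<Rightarrow> complex ^ 'n::{finite,linorder} \<Rightarrow> complex"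
where
  "Phi q \<alpha> \<tau> a b w = Lim (at w within Phi_dom q \<tau> b) (Phi_formula q \<alpha> \<tau> a b)"

text \<open>
  Being a pole does not depend on the choice of the logarithms \<open>w\<close> of \<open>z\<close>: changing them multiplies
  the formula by a nonzero constant.
\<close>

definition Phi_pole ::
  "real \<Rightarrow> complex \<Rightarrow> complex \<Rightarrow> complex \<Rightarrow> complex \<Rightarrow> complex ^ 'n::{finite,linorder} \<Rightarrow> bool"
where
  "Phi_pole q \<alpha> \<tau> a b z \<longleftrightarrow>
    (\<exists>w. (\<forall>i. exp (w $ i) = z $ i) \<and>
         \<not> (\<exists>c. (Phi_formula q \<alpha> \<tau> a b \<longlongrightarrow> c) (at w within Phi_dom q \<tau> b)))"

definition Delta :: "complex ^ 'n::{finite,linorder} \<Rightarrow> complex" where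
  "Delta z = (\<Prod>(i, j)\<in>{(i, j). i < j}. (z $ i - z $ j))"

definition lattice_point :: "real \<Rightarrow> complex ^ 'n \<Rightarrow> int ^ 'n \<Rightarrow> complex ^ 'n" where
  "lattice_point q x \<nu> = (\<chi> i. x $ i * of_real q powi (\<nu> $ i))"

text \<open>
  If \<open>L\<^sub>i\<close> is the chosen logarithm of \<open>x\<^sub>i\<close>, these are the logarithms of the coordinates of \<open>x q\<^sup>\<nu>\<close>
  for which \<open>(x\<^sub>i q\<^sup>\<nu>)\<^sup>s = x\<^sub>i\<^sup>s q\<^sup>s\<^sup>\<nu>\<close>.
\<close>

definition lattice_log :: "real \<Rightarrow> complex ^ 'n \<Rightarrow> int ^ 'n \<Rightarrow> complex ^ 'n" where
  "lattice_log q L \<nu> = (\<chi> i. L $ i + of_int (\<nu> $ i) * of_real (ln q))"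

definition jackson_I ::
  "real \<Rightarrow> complex \<Rightarrow> complex \<Rightarrow> complex \<Rightarrow> complex \<Rightarrow>
    complex ^ 'n::{finite,linorder} \<Rightarrow> complex ^ 'n::{finite,linorder} \<Rightarrow> complex"
where
  "jackson_I q \<alpha> \<tau> a b L x =
    of_real (1 - q) ^ CARD('n) *
    (\<Sum>\<^sub>\<infinity>\<nu>\<in>UNIV. Phi q \<alpha> \<tau> a b (lattice_log q L \<nu>) * Delta (lattice_point q x \<nu>))"

end

theory Submission
  imports Defs
begin

text \<open>
  Let \<open>\<sigma>\<close> exchange the \<open>i\<close>-th and \<open>j\<close>-th coordinates. Since \<open>x\<^sub>i = x\<^sub>j\<close>, \<open>\<sigma>\<close> permutes the lattice, and
  \<open>\<Delta>\<close> is antisymmetric, so it suffices that \<open>\<Phi>\<close> is \<open>\<sigma>\<close>-invariant on the lattice.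

  First, \<open>t\<close> is not an integer power of \<open>q\<close>: positive exponents are excluded by hypothesis, and for
  \<open>t = q\<^sup>-\<^sup>m\<close> with \<open>m \<ge> 0\<close> the factor \<open>(t z\<^sub>j/z\<^sub>i)\<^sub>\<infinity>\<close> in the denominator vanishes on \<open>z\<^sub>i = z\<^sub>j\<close> while all other
  factors are finite and nonzero at generic points of this divisor, so that \<open>x\<close> would be a pole.

  The two-variable factor \<open>h(z\<^sub>j, z\<^sub>k)\<close> of \<open>\<Phi>\<close> has the property that \<open>h(z\<^sub>j, z\<^sub>k) / h(z\<^sub>k, z\<^sub>j)\<close> is invariant
  under \<open>z\<^sub>j \<mapsto> q z\<^sub>j\<close>. On the slice where \<open>z\<^sub>i/z\<^sub>j\<close> is a fixed power of \<open>q\<close> this gives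
  \<open>\<Phi>(\<sigma>z) = \<Phi>(z)\<close> at generic \<open>z\<close>, and the value of \<open>\<Phi>\<close> at a lattice point is the limit along a generic
  line in this slice.
\<close>

section \<open>The infinite product: convergence, q-shift, zeros and continuity\<close>

lemma qpoch_inf_convergent:
  fixes a :: complex
  assumes "0 < q" "q < 1"
  shows "convergent_prod (\<lambda>i. 1 - of_real q ^ i * a)"
proof -
  have "summable (\<lambda>i. q ^ i * norm a)"
    using assms by (intro summable_mult2 summable_geometric) auto
  then have "summable (\<lambda>i. norm (1 - of_real q ^ i * a - 1))"
    using assms by (simp add: norm_mult norm_power)
  then show ?thesis
    by (intro abs_convergent_prod_imp_convergent_prod summable_imp_abs_convergent_prod)
qed

lemma qpoch_inf_LIMSEQ:
  assumes "0 < q" "q < 1"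
  shows "(\<lambda>n. \<Prod>i<n. 1 - of_real q ^ i * a) \<longlonglongrightarrow> qpoch_inf q a"
  using convergent_prod_LIMSEQ[OF qpoch_inf_convergent[OF assms, of a]]
  by (simp add: qpoch_inf_def LIMSEQ_lessThan_iff_atMost)

lemma qpoch_inf_shift:
  assumes "0 < q" "q < 1"
  shows "qpoch_inf q a = (1 - a) * qpoch_inf q (of_real q * a)"
proof -
  have "(\<lambda>n. \<Prod>i<Suc n. 1 - of_real q ^ i * a) = 
        (\<lambda>n. (1 - a) * (\<Prod>i<n. 1 - of_real q ^ i * (of_real q * a)))"
    by (subst prod.lessThan_Suc_shift) (simp add: mult_ac)
  then have "(\<lambda>n. \<Prod>i<Suc n. 1 - of_real q ^ i * a) \<longlonglongrightarrow> (1 - a) * qpoch_inf q (of_real q * a)"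
    using tendsto_mult_left[OF qpoch_inf_LIMSEQ[OF assms]] by simp
  moreover have "(\<lambda>n. \<Prod>i<Suc n. 1 - of_real q ^ i * a) \<longlonglongrightarrow> qpoch_inf q a"
    using qpoch_inf_LIMSEQ[OF assms] by (rule LIMSEQ_Suc)
  ultimately show ?thesis
    using LIMSEQ_unique by blast
qed

text \<open>The q-shift lowers the exponent from Suc m to m; at m = 0 the factor split off is itself
  0.\<close>

lemma qpoch_inf_eq_0:
  assumes "0 < q" "q < 1"
  shows "qpoch_inf q (inverse (of_real q ^ m)) = 0"
proof (induction m)
  case 0
  show ?case by (subst qpoch_inf_shift[OF assms]) simp
next
  case (Suc m)
  have "of_real q * inverse (of_real q ^ Suc m) = inverse (of_real q ^ m :: complex)"
    using assms by (simp add: field_simps)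
  then show ?case
    using Suc qpoch_inf_shift[OF assms, of "inverse (of_real q ^ Suc m)"] by (simp only: mult_zero_right)
qed

text \<open>Comparison with a geometric series makes the partial products converge uniformly on
  closed balls.\<close>

lemma continuous_on_qpoch_inf:
  assumes "0 < q" "q < 1"
  shows "continuous_on UNIV (qpoch_inf q)"
proof -
  have "isCont (qpoch_inf q) a" for a
  proof -
    \<comment> \<open>The extra 1 makes a an interior point of the ball, so continuity on the ball
      gives continuity at a.\<close>
    define R where "R = norm a + 1"
    have "uniformly_convergent_on (cball 0 R) (\<lambda>N x. \<Sum>n<N. norm (1 - of_real q ^ n * x - 1 :: complex))"
    proof (rule Weierstrass_m_test')
      show "summable (\<lambda>n. q ^ n * R)"
        using assms by (intro summable_mult2 summable_geometric) auto
      show "norm (norm (1 - of_real q ^ n * x - 1 :: complex)) \<le> q ^ n * R" if "x \<in> cball 0 R" for n x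
        using mult_left_mono[of "norm x" R "q ^ n"] that assms by (simp add: norm_mult norm_power)
    qed
    then have "uniformly_convergent_on (cball 0 R) (\<lambda>N x. \<Prod>n<N. 1 - of_real q ^ n * x :: complex)"
      by (intro uniformly_convergent_on_prod') (auto intro!: continuous_intros)
    then obtain l where l: "uniform_limit (cball 0 R) (\<lambda>N x. \<Prod>n<N. 1 - of_real q ^ n * x :: complex) l sequentially"
      unfolding uniformly_convergent_on_def by blast
    have "l x = qpoch_inf q x" if "x \<in> cball 0 R" for x
      using tendsto_uniform_limitI[OF l that] qpoch_inf_LIMSEQ[OF assms] LIMSEQ_unique by blast
    moreover have "continuous_on (cball 0 R) l"
      by (rule uniform_limit_theorem[OF _ l]) (auto intro!: always_eventually continuous_intros)
    ultimately have "continuous_on (cball 0 R) (qpoch_inf q)"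
      using continuous_on_cong[of "cball 0 R" "cball 0 R" l "qpoch_inf q"] by simp
    then have "continuous_on (ball 0 R) (qpoch_inf q)"
      by (rule continuous_on_subset) auto
    then show ?thesis
      by (rule continuous_on_interior) (simp add: R_def)
  qed
  then show ?thesis by (simp add: continuous_on_eq_continuous_at)
qed

lemma qpoch_inf_nonzero_if_factors_nonzero:
  assumes "0 < q" "q < 1" "\<And>i. of_real q ^ i * a \<noteq> 1"
  shows "qpoch_inf q a \<noteq> 0"
  unfolding qpoch_inf_def
  using assms(3) by (intro prodinf_nonzero[OF qpoch_inf_convergent[OF assms(1,2)]]) simp

lemma tendsto_qpoch_inf:
  assumes "0 < q" "q < 1" "(f \<longlongrightarrow> c) F"
  shows "((\<lambda>x. qpoch_inf q (f x)) \<longlongrightarrow> qpoch_inf q c) F"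
  using continuous_on_tendsto_compose[OF continuous_on_qpoch_inf[OF assms(1,2)] assms(3)] by simp

section \<open>Integer powers of q and generic parameters\<close>

text \<open>The zeros of \<open>qpoch_inf q\<close> are only the powers with exponent at most 0. The
  whole group is the set to avoid because it is stable under inversion and under multiplication by
  q.\<close>

definition qpowers :: "real \<Rightarrow> complex set" where
  "qpowers q = range (\<lambda>m::int. of_real q powi m)"

lemma qpowers_inverse_iff: "inverse c \<in> qpowers q \<longleftrightarrow> c \<in> qpowers q"
proof -
  have *: "inverse c \<in> qpowers q" if "c \<in> qpowers q" for c
    using that by (auto simp: qpowers_def power_int_minus[symmetric])
  show ?thesis using *[of c] *[of "inverse c"] by auto
qed

lemma qpowers_mult_iff:
  assumes "0 < q" "r \<in> qpowers q"
  shows "r * c \<in> qpowers q \<longleftrightarrow> c \<in> qpowers q"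
proof -
  have *: "r * c \<in> qpowers q" if "r \<in> qpowers q" "c \<in> qpowers q" for r c
    using that assms(1) by (auto simp: qpowers_def power_int_add[symmetric])
  have "r \<noteq> 0"
    using assms by (auto simp: qpowers_def)
  then show ?thesis
    using *[of r c] *[of "inverse r" "r * c"] assms(2) by (auto simp: qpowers_inverse_iff mult.assoc[symmetric])
qed

lemma powi_in_qpowers [simp]: "of_real q powi m \<in> qpowers q"
  by (auto simp: qpowers_def)

lemma base_in_qpowers [simp]: "of_real q \<in> qpowers q"
  using powi_in_qpowers[of q 1] by simp

lemma qpoch_inf_nonzero:
  assumes "0 < q" "q < 1" "a \<notin> qpowers q"
  shows "qpoch_inf q a \<noteq> 0"
proof (rule qpoch_inf_nonzero_if_factors_nonzero[OF assms(1,2)])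
  fix i
  show "of_real q ^ i * a \<noteq> 1"
  proof
    assume "of_real q ^ i * a = 1"
    then have "a = of_real q powi (- int i)"
      using assms(1) by (simp add: power_int_minus field_simps)
    then show False using assms(3) by simp
  qed
qed

lemma exp_int_mult_ln:
  assumes "0 < q"
  shows "exp (of_int m * of_real (ln q)) = (of_real q powi m :: complex)"
  using exp_power_int[of "of_real (ln q) :: complex" m] assms by (simp add: exp_of_real)

text \<open>For c and d nonzero the curve is injective in s, so it meets the countable set
  \<open>qpowers q\<close> countably often. For d = 0 it is constant, and c = 0 never yields a power
  of q.\<close>

lemma countable_exp_in_qpowers:
  fixes d :: real
  assumes "0 < q" "d \<noteq> 0 \<or> c \<notin> qpowers q"
  shows "countable {s. c * exp (of_real (s * d)) \<in> qpowers q}"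
proof (cases "d = 0")
  case True
  then show ?thesis using assms by simp
next
  case False
  have "inj_on (\<lambda>s. c * exp (of_real (s * d))) {s. c * exp (of_real (s * d)) \<in> qpowers q}"
  proof (cases "c = 0")
    case True
    then show ?thesis using assms(1) by (auto simp: qpowers_def)
  next
    case c: False
    show ?thesis
      by (rule inj_onI) (use False c in \<open>simp add: exp_of_real del: of_real_mult\<close>)
  qed
  then show ?thesis
    by (rule countable_image_inj_on[rotated]) (rule countable_subset[of _ "qpowers q"], auto simp: qpowers_def)
qed

text \<open>Intervals are uncountable, so limits stay unique after countably many parameters are
  discarded.\<close>

lemma at_within_co_countable_neq_bot:
  fixes x :: real
  assumes "countable B"
  shows "at x within - B \<noteq> bot"
proof -
  have "x islimpt - B"
    unfolding islimpt_approachable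
  proof (intro allI impI)
    fix e :: real assume "0 < e"
    then have "\<not> {x<..<x+e} \<subseteq> B"
      using uncountable_open_interval[of x "x+e"] assms countable_subset by auto
    then obtain y where "y \<in> {x<..<x+e}" "y \<notin> B" by blast
    then show "\<exists>x'\<in>- B. x' \<noteq> x \<and> dist x' x < e"
      by (intro bexI[of _ y]) (auto simp: dist_real_def)
  qed
  then show ?thesis by (simp add: trivial_limit_within)
qed

section \<open>Products over ordered pairs under a transposition\<close>

text \<open>Groups the pairs by how the transposition of i and j acts on them; \<open>min\<close>
  and \<open>max\<close> write the pairs joining k to i and to j in increasing order wherever k
  lies.\<close>

lemma prod_ordered_pairs_split:
  fixes g :: "'n::{finite,linorder} \<Rightarrow> 'n \<Rightarrow> 'a::comm_monoid_mult"
  assumes "i < j"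
  shows "(\<Prod>(a, b)\<in>{(a, b). a < b}. g a b) =
    (\<Prod>(a, b)\<in>{(a, b). a < b \<and> a \<notin> {i, j} \<and> b \<notin> {i, j}}. g a b) * g i j *
    (\<Prod>k\<in>- {i, j}. g (min i k) (max i k) * g (min j k) (max j k))"
proof -
  let ?A = "{(a, b). a < b \<and> a \<notin> {i, j} \<and> b \<notin> {i, j}}"
  let ?f = "\<lambda>l k. (min l k, max l k)"
  have eq: "{(a, b). a < b} = (?A \<union> {(i, j)}) \<union> (?f i ` (- {i, j}) \<union> ?f j ` (- {i, j}))"
  proof (intro equalityI subsetI)
    fix p :: "'n \<times> 'n" assume "p \<in> {(a, b). a < b}"
    then obtain a b where p: "p = (a, b)" "a < b" by auto
    have "a \<le> b" "\<not> b \<le> a" using p by auto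
    then have "p = ?f a b" "p = ?f b a" using p by (simp_all add: min_def max_def)
    consider "a \<notin> {i, j}" "b \<notin> {i, j}" | "a \<in> {i, j}" "b \<notin> {i, j}" | "a \<notin> {i, j}" "b \<in> {i, j}" | "a = i" "b = j"
    proof -
      have "a \<noteq> b" "\<not> (a = j \<and> b = i)" using p assms by auto
      then show thesis using that by blast
    qed
    then show "p \<in> (?A \<union> {(i, j)}) \<union> (?f i ` (- {i, j}) \<union> ?f j ` (- {i, j}))"
    proof cases
      case 2
      then have "p \<in> ?f a ` (- {i, j})" using \<open>p = ?f a b\<close> by blast
      moreover have "a = i \<or> a = j" using 2 by simp
      ultimately have "p \<in> ?f i ` (- {i, j}) \<or> p \<in> ?f j ` (- {i, j})" by fast
      then show ?thesis by (simp only: Un_iff) fast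
    next
      case 3
      then have "p \<in> ?f b ` (- {i, j})" using \<open>p = ?f b a\<close> by blast
      moreover have "b = i \<or> b = j" using 3 by simp
      ultimately have "p \<in> ?f i ` (- {i, j}) \<or> p \<in> ?f j ` (- {i, j})" by fast
      then show ?thesis by (simp only: Un_iff) fast
    qed (use p in auto)
  qed (use assms in \<open>auto simp: min_def max_def split: if_splits\<close>)
  have inj: "inj_on (?f l) (- {i, j})" for l
    by (rule inj_onI) (auto simp: min_def max_def split: if_splits)
  have "(\<Prod>(a, b)\<in>{(a, b). a < b}. g a b) =
      (\<Prod>(a, b)\<in>?A. g a b) * g i j * ((\<Prod>(a, b)\<in>?f i ` (- {i, j}). g a b) * (\<Prod>(a, b)\<in>?f j ` (- {i, j}). g a b))"
    unfolding eq
    using assms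
    by (subst prod.union_disjoint, simp, simp, (force simp: min_def max_def split: if_splits)[1],
        subst prod.union_disjoint, simp, simp, simp,
        subst prod.union_disjoint, simp, simp, (force simp: min_def max_def split: if_splits)[1], simp)
  also have "(\<Prod>(a, b)\<in>?f i ` (- {i, j}). g a b) * (\<Prod>(a, b)\<in>?f j ` (- {i, j}). g a b) =
      (\<Prod>k\<in>- {i, j}. g (min i k) (max i k) * g (min j k) (max j k))"
    by (simp add: prod.reindex[OF inj] prod.distrib)
  finally show ?thesis .
qed

text \<open>For k < i or k > j the two pairs containing k are merely exchanged. For k strictly
  between, their order is also reversed, which the last assumption repairs; the pair (i, j)
  contributes c. It is applied with c = 1 to \<Phi> and c = -1 to \<Delta>.\<close>

lemma prod_ordered_pairs_transpose:
  fixes g :: "'n::{finite,linorder} \<Rightarrow> 'n \<Rightarrow> 'a::comm_monoid_mult"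
  assumes "i < j" "g j i = c * g i j"
    and "\<And>k. i < k \<Longrightarrow> k < j \<Longrightarrow> g j k * g k i = g i k * g k j"
  shows "(\<Prod>(a, b)\<in>{(a, b). a < b}. g (Transposition.transpose i j a) (Transposition.transpose i j b)) =
    c * (\<Prod>(a, b)\<in>{(a, b). a < b}. g a b)"
proof -
  let ?s = "Transposition.transpose i j"
  let ?A = "{(a, b). a < b \<and> a \<notin> {i, j} \<and> b \<notin> {i, j}}"
  have 1: "(\<Prod>(a, b)\<in>?A. g (?s a) (?s b)) = (\<Prod>(a, b)\<in>?A. g a b)"
    by (rule prod.cong) auto
  have 2: "g (?s (min i k)) (?s (max i k)) * g (?s (min j k)) (?s (max j k)) =
      g (min i k) (max i k) * g (min j k) (max j k)" if "k \<in> - {i, j}" for k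
  proof -
    consider "k < i" | "i < k" "k < j" | "j < k" 
      using \<open>k \<in> - {i, j}\<close> by fastforce
    then show ?thesis
    proof cases
      case 2
      then have "i \<le> k" "\<not> j \<le> k" by auto
      then show ?thesis using assms(3)[OF 2] that by (simp add: min_def max_def mult.commute)
    qed (use assms(1) that in \<open>auto simp: min_def max_def mult.commute\<close>)
  qed
  have 3: "(\<Prod>k\<in>- {i, j}. g (?s (min i k)) (?s (max i k)) * g (?s (min j k)) (?s (max j k))) =
      (\<Prod>k\<in>- {i, j}. g (min i k) (max i k) * g (min j k) (max j k))"
    by (intro prod.cong refl 2)
  show ?thesis
    unfolding prod_ordered_pairs_split[OF assms(1)] 1 3 transpose_apply_first transpose_apply_second assms(2)
    by (simp only: mult_ac)
qed

section \<open>The two-variable factor and its quasi-periodicity\<close>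

definition pair_factor :: "real \<Rightarrow> complex \<Rightarrow> complex \<Rightarrow> complex \<Rightarrow> complex" where
  "pair_factor q \<tau> x y = exp ((2 * \<tau> - 1) * x) *
    (qpoch_inf q (of_real q * inverse (of_real q powr \<tau>) * (exp y / exp x)) /
     qpoch_inf q (of_real q powr \<tau> * (exp y / exp x)))"

text \<open>The numerator argument is q / (t exp (x - y)), so the condition on x - y controls the
  numerator and the one on y - x the denominator.\<close>

lemma pair_factor_nonzero:
  assumes "0 < q" "q < 1"
    and "of_real q powr \<tau> * exp (x - y) \<notin> qpowers q" "of_real q powr \<tau> * exp (y - x) \<notin> qpowers q"
  shows "pair_factor q \<tau> x y \<noteq> 0"
proof -
  have "of_real q * inverse (of_real q powr \<tau>) * (exp y / exp x) =
      of_real q * inverse (of_real q powr \<tau> * exp (x - y))"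
    by (simp add: exp_diff field_simps)
  then have "of_real q * inverse (of_real q powr \<tau>) * (exp y / exp x) \<notin> qpowers q"
    using assms by (simp only: qpowers_mult_iff qpowers_inverse_iff base_in_qpowers not_False_eq_True)
  then show ?thesis
    using assms qpoch_inf_nonzero by (simp add: pair_factor_def exp_diff)
qed

text \<open>Shifting x by ln q multiplies the argument of each of the four products by q or 1/q, so
  each changes by one linear factor. The power contributes q^(2\<tau> - 1) = t^2 / q, and all these
  contributions cancel in the ratio.\<close>

lemma pair_factor_quasi_periodic:
  assumes q: "0 < q" "q < 1"
    and "of_real q powr \<tau> * exp (x - y) \<notin> qpowers q" "of_real q powr \<tau> * exp (y - x) \<notin> qpowers q"
  shows "pair_factor q \<tau> (x + of_real (ln q)) y / pair_factor q \<tau> y (x + of_real (ln q)) =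
    pair_factor q \<tau> x y / pair_factor q \<tau> y x"
proof -
  define t u Q where "t = of_real q powr \<tau>" and "u = exp (y - x)" and "Q = (of_real q :: complex)"
  have nz: "t \<noteq> 0" "u \<noteq> 0" "Q \<noteq> 0"
    using q by (auto simp: t_def u_def Q_def)
  have tu: "t * u \<notin> qpowers q" "t / u \<notin> qpowers q"
    using assms(3,4) by (auto simp: t_def u_def exp_diff)
  have ne: "1 - t * u / Q \<noteq> 0" "1 - t / u \<noteq> 0"
  proof -
    show "1 - t * u / Q \<noteq> 0"
    proof
      assume "1 - t * u / Q = 0"
      then have "t * u = Q" using nz by (simp add: field_simps)
      then show False using tu by (simp add: Q_def)
    qed
    show "1 - t / u \<noteq> 0"
    proof
      assume "1 - t / u = 0"
      then have "t / u = of_real q powi 0" by simp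
      then show False using tu(2) powi_in_qpowers by metis
    qed
  qed
  have expQ: "exp (x + of_real (ln q)) = Q * exp x"
    using q by (simp add: exp_add exp_of_real Q_def)
  have uexp: "exp y = u * exp x"
    by (simp add: u_def exp_diff)
  have "t = exp (\<tau> * of_real (ln q))"
    using q by (simp add: t_def powr_def Ln_of_real)
  then have t2: "exp ((2 * \<tau> - 1) * of_real (ln q)) = t ^ 2 / Q"
    using q by (simp add: Q_def exp_diff exp_of_real exp_double[symmetric] left_diff_distrib mult.assoc)
  have pf: "pair_factor q \<tau> x y = exp ((2 * \<tau> - 1) * x) *
    (qpoch_inf q (Q * inverse t * (exp y / exp x)) / qpoch_inf q (t * (exp y / exp x)))" for x y
    by (simp add: pair_factor_def t_def Q_def)
  have e: "exp ((2 * \<tau> - 1) * (x + of_real (ln q))) = exp ((2 * \<tau> - 1) * x) * (t ^ 2 / Q)"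
    unfolding distrib_left exp_add t2 ..
  have "Q * inverse t * (exp y / exp (x + of_real (ln q))) = u / t"
    "t * (exp y / exp (x + of_real (ln q))) = t * u / Q"
    using nz by (simp_all add: expQ uexp field_simps)
  then have 1: "pair_factor q \<tau> (x + of_real (ln q)) y =
      exp ((2 * \<tau> - 1) * x) * (t ^ 2 / Q) * (qpoch_inf q (u / t) / qpoch_inf q (t * u / Q))"
    unfolding pf e by simp
  have "Q * inverse t * (exp (x + of_real (ln q)) / exp y) = Q * (Q / (t * u))"
    "t * (exp (x + of_real (ln q)) / exp y) = Q * (t / u)"
    using nz by (simp_all add: expQ uexp field_simps)
  then have 2: "pair_factor q \<tau> y (x + of_real (ln q)) =
      exp ((2 * \<tau> - 1) * y) * (qpoch_inf q (Q * (Q / (t * u))) / qpoch_inf q (Q * (t / u)))"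
    unfolding pf by simp
  have "Q * inverse t * (exp x / exp y) = Q / (t * u)" "t * (exp x / exp y) = t / u"
    using nz by (simp_all add: uexp field_simps)
  then have 3: "pair_factor q \<tau> y x =
      exp ((2 * \<tau> - 1) * y) * (qpoch_inf q (Q / (t * u)) / qpoch_inf q (t / u))"
    unfolding pf by simp
  have "Q * inverse t * (exp y / exp x) = Q * (u / t)" "t * (exp y / exp x) = Q * (t * u / Q)"
    using nz by (simp_all add: uexp field_simps)
  then have 4: "pair_factor q \<tau> x y =
      exp ((2 * \<tau> - 1) * x) * (qpoch_inf q (Q * (u / t)) / qpoch_inf q (Q * (t * u / Q)))"
    unfolding pf by simp
  note shift = qpoch_inf_shift[OF q, folded Q_def]
  \<comment> \<open>The quantity 1 - Q / (t u) is a factor of the numerator here, so its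
    nonvanishing can be read off.\<close>
  have "pair_factor q \<tau> y x \<noteq> 0"
    using pair_factor_nonzero[OF q assms(4,3)] .
  then have ne': "1 - Q / (t * u) \<noteq> 0"
    unfolding 3 shift[of "Q / (t * u)"] shift[of "t / u"] by auto
  \<comment> \<open>The algebraic core: the four linear factors produced by the shifts balance
    exactly against t^2 / Q.\<close>
  have "t ^ 2 / Q * (1 - u / t) * (1 - Q / (t * u)) = (1 - t * u / Q) * (1 - t / u)"
    using nz by (simp add: field_simps power2_eq_square)
  then have ratio: "t ^ 2 / Q * (1 - u / t) / (1 - t * u / Q) = (1 - t / u) / (1 - Q / (t * u))"
    by (simp only: frac_eq_eq[OF ne(1) ne'] mult_ac)
  have main: "t ^ 2 / Q * ((1 - u / t) * A / ((1 - t * u / Q) * B)) * X / (Y * (C / D)) =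
      X * (A / B) / (Y * ((1 - Q / (t * u)) * C / ((1 - t / u) * D)))" for A B C D X Y
  proof -
    have "t ^ 2 / Q * ((1 - u / t) * A / ((1 - t * u / Q) * B)) * X / (Y * (C / D)) =
       (t ^ 2 / Q * (1 - u / t) / (1 - t * u / Q)) * (A / B * X / (Y * (C / D)))"
      by (simp add: mult_ac)
    also have "\<dots> = (1 - t / u) / (1 - Q / (t * u)) * (A / B * X / (Y * (C / D)))"
      by (simp only: ratio)
    finally show ?thesis
      by (simp only: times_divide_eq_left times_divide_eq_right divide_divide_eq_left divide_divide_eq_right mult_ac)
  qed
  show ?thesis
    unfolding 1 2 3 4 shift[of "Q / (t * u)"] shift[of "t / u"] shift[of "u / t"] shift[of "t * u / Q"]
    using main[of "qpoch_inf q (Q * (u / t))" "qpoch_inf q (Q * (t * u / Q))" "exp ((2 * \<tau> - 1) * x)"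
       "exp ((2 * \<tau> - 1) * y)" "qpoch_inf q (Q * (Q / (t * u)))" "qpoch_inf q (Q * (t / u))"]
    by (simp only: mult_ac)
qed

lemma pair_factor_periodic_int:
  assumes q: "0 < q" "q < 1"
    and "of_real q powr \<tau> * exp (x - y) \<notin> qpowers q" "of_real q powr \<tau> * exp (y - x) \<notin> qpowers q"
  shows "pair_factor q \<tau> (x + of_int N * of_real (ln q)) y / pair_factor q \<tau> y (x + of_int N * of_real (ln q)) =
    pair_factor q \<tau> x y / pair_factor q \<tau> y x"
proof -
  let ?R = "\<lambda>m::int. pair_factor q \<tau> (x + of_int m * of_real (ln q)) y / pair_factor q \<tau> y (x + of_int m * of_real (ln q))"
  have step: "?R (m + 1) = ?R m" for m
  proof -
    \<comment> \<open>Integer shifts multiply these arguments by powers of q, so they stay outside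
      \<open>qpowers q\<close> and the one-step lemma applies at every m.\<close>
    have "of_real q powr \<tau> * exp (x + of_int m * of_real (ln q) - y) = of_real q powi m * (of_real q powr \<tau> * exp (x - y))"
      by (simp add: exp_add exp_diff exp_int_mult_ln[OF q(1)])
    moreover have "of_real q powr \<tau> * exp (y - (x + of_int m * of_real (ln q))) = 
        of_real q powi (-m) * (of_real q powr \<tau> * exp (y - x))"
      by (simp add: exp_add exp_diff exp_int_mult_ln[OF q(1)] power_int_minus field_simps)
    ultimately have "pair_factor q \<tau> (x + of_int m * of_real (ln q) + of_real (ln q)) y /
        pair_factor q \<tau> y (x + of_int m * of_real (ln q) + of_real (ln q)) = ?R m"
      using assms by (intro pair_factor_quasi_periodic[OF q]) (simp_all only: qpowers_mult_iff powi_in_qpowers not_False_eq_True)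
    moreover have "x + of_int (m + 1) * of_real (ln q) = x + of_int m * of_real (ln q) + of_real (ln q)"
      by (simp add: distrib_right)
    ultimately show ?thesis by (simp only:)
  qed
  have "?R N = ?R 0"
  proof (induction N rule: int_induct[where k = 0])
    \<comment> \<open>Downwards, the step from i - 1 to i is read backwards.\<close>
    case (step2 i)
    then show ?case using step[of "i - 1"] by simp
  qed (use step in simp_all)
  then show ?thesis by simp
qed

section \<open>Swapping two coordinates in the formula for \<Phi> and in \<Delta>\<close>

definition coord_factor :: "real \<Rightarrow> complex \<Rightarrow> complex \<Rightarrow> complex \<Rightarrow> complex \<Rightarrow> complex" where
  "coord_factor q \<alpha> a b x =
    exp (\<alpha> * x) * (qpoch_inf q (of_real q * inverse a * exp x) / qpoch_inf q (b * exp x))"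

lemma Phi_formula_factors:
  "Phi_formula q \<alpha> \<tau> a b w =
    (\<Prod>l\<in>UNIV. coord_factor q \<alpha> a b (w $ l)) * (\<Prod>(k, l)\<in>{(k, l). k < l}. pair_factor q \<tau> (w $ k) (w $ l))"
  by (simp add: Phi_formula_def coord_factor_def pair_factor_def Let_def)

definition swap_coords :: "'n \<Rightarrow> 'n \<Rightarrow> 'a ^ 'n \<Rightarrow> 'a ^ 'n" where
  "swap_coords i j w = (\<chi> l. w $ Transposition.transpose i j l)"

lemma swap_coords_nth [simp]: "swap_coords i j w $ l = w $ Transposition.transpose i j l"
  by (simp add: swap_coords_def)

lemma prod_swap_coords:
  fixes w :: "'a ^ 'n::finite" and f :: "'a \<Rightarrow> 'b::comm_monoid_mult"
  shows "(\<Prod>l\<in>UNIV. f (swap_coords i j w $ l)) = (\<Prod>l\<in>UNIV. f (w $ l))"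
  unfolding swap_coords_nth
  by (rule prod.reindex_bij_betw[where g = "\<lambda>l. f (w $ l)"]) simp

lemma Phi_formula_swap_coords:
  fixes w :: "complex ^ 'n::{finite,linorder}"
  assumes q: "0 < q" "q < 1" and "i < j"
    and gen: "\<And>k l. k \<noteq> l \<Longrightarrow> of_real q powr \<tau> * exp (w $ k - w $ l) \<notin> qpowers q"
    and N: "w $ i = w $ j + of_int N * of_real (ln q)"
    and t: "of_real q powr \<tau> \<notin> qpowers q"
  shows "Phi_formula q \<alpha> \<tau> a b (swap_coords i j w) = Phi_formula q \<alpha> \<tau> a b w"
proof -
  let ?g = "\<lambda>k l. pair_factor q \<tau> (w $ k) (w $ l)"
  have nz: "?g k l \<noteq> 0" if "k \<noteq> l" for k l
    using pair_factor_nonzero[OF q gen gen] that by metis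
  \<comment> \<open>With both arguments at w $ j the ratio is 1, and t outside
    \<open>qpowers q\<close> makes the factor nonzero there. Shifting the first argument by N ln q
    turns it into w $ i.\<close>
  have ji: "?g j i = 1 * ?g i j"
    using pair_factor_periodic_int[OF q, of \<tau> "w $ j" "w $ j" N] pair_factor_nonzero[OF q, of \<tau> "w $ j" "w $ j"]
      t nz[of i j] nz[of j i] \<open>i < j\<close>
    by (simp add: N)
  \<comment> \<open>As w $ i is a shift of w $ j, both have the same ratio against w $ k.\<close>
  have mid: "?g j k * ?g k i = ?g i k * ?g k j" if "i < k" "k < j" for k
  proof -
    have "?g i k / ?g k i = ?g j k / ?g k j"
      using pair_factor_periodic_int[OF q gen gen, of j k N] that by (simp add: N)
    then show ?thesis
      using nz[of k i] nz[of k j] that by (simp add: frac_eq_eq mult.commute)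
  qed
  show ?thesis
    unfolding Phi_formula_factors prod_swap_coords
    using prod_ordered_pairs_transpose[of i j ?g 1, OF \<open>i < j\<close> ji mid] by simp
qed

lemma Delta_swap_coords:
  assumes "i < j"
  shows "Delta (swap_coords i j z) = - Delta z"
  using prod_ordered_pairs_transpose[of i j "\<lambda>k l. z $ k - z $ l" "-1", OF assms]
  by (simp add: Delta_def algebra_simps)

section \<open>Generic lines in logarithmic coordinates\<close>

text \<open>Along the line z_k / z_l changes by exp (s (v k - v l)): equal entries of v freeze the
  quotient, unequal ones move it.\<close>

definition line :: "complex ^ 'n \<Rightarrow> ('n \<Rightarrow> real) \<Rightarrow> real \<Rightarrow> complex ^ 'n" where
  "line w v s = (\<chi> l. w $ l + of_real (s * v l))"

lemma line_nth [simp]: "line w v s $ l = w $ l + of_real (s * v l)"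
  by (simp add: line_def)

lemma line_tendsto: "((\<lambda>s. line w v s) \<longlongrightarrow> w) (at 0 within S)"
proof (rule vec_tendstoI)
  fix l
  have "((\<lambda>s. w $ l + of_real (s * v l)) \<longlongrightarrow> w $ l + of_real (0 * v l)) (at 0 within S)"
    by (intro tendsto_intros)
  then show "((\<lambda>s. line w v s $ l) \<longlongrightarrow> w $ l) (at 0 within S)" by simp
qed

lemma exp_line_diff:
  "c * exp (line w v s $ k - line w v s $ l) = c * exp (w $ k - w $ l) * exp (of_real (s * (v k - v l)))"
  by (simp add: exp_add[symmetric] algebra_simps)

lemma exp_line: "c * exp (line w v s $ k) = c * exp (w $ k) * exp (of_real (s * v k))"
  by (simp add: exp_add)

lemma mem_Phi_dom:
  assumes "0 < q" "q < 1"
    and "\<And>l. b * exp (w $ l) \<notin> qpowers q"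
    and "\<And>k l. k \<noteq> l \<Longrightarrow> of_real q powr \<tau> * exp (w $ k - w $ l) \<notin> qpowers q"
  shows "w \<in> Phi_dom q \<tau> b"
  using assms qpoch_inf_nonzero[OF assms(1,2)] by (auto simp: Phi_dom_def exp_diff[symmetric])

lemma countable_line_coord:
  fixes w :: "complex ^ 'n::finite"
  assumes "0 < q" "\<And>l. v l \<noteq> 0 \<or> c * exp (w $ l) \<notin> qpowers q"
  shows "countable {s. \<exists>l. c * exp (line w v s $ l) \<in> qpowers q}"
proof -
  have "countable {s. c * exp (line w v s $ l) \<in> qpowers q}" for l
    unfolding exp_line using assms by (rule countable_exp_in_qpowers)
  then have "countable (\<Union>l. {s. c * exp (line w v s $ l) \<in> qpowers q})"
    by (intro countable_UN) auto
  also have "(\<Union>l. {s. c * exp (line w v s $ l) \<in> qpowers q}) =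
      {s. \<exists>l. c * exp (line w v s $ l) \<in> qpowers q}"
    by (auto simp del: line_nth)
  finally show ?thesis .
qed

lemma countable_line_diff:
  fixes w :: "complex ^ 'n::finite"
  assumes "0 < q" "\<And>k l. (k, l) \<in> P \<Longrightarrow> v k \<noteq> v l \<or> c * exp (w $ k - w $ l) \<notin> qpowers q"
  shows "countable {s. \<exists>(k, l)\<in>P. c * exp (line w v s $ k - line w v s $ l) \<in> qpowers q}"
proof -
  have "countable {s. c * exp (line w v s $ k - line w v s $ l) \<in> qpowers q}" if "(k, l) \<in> P" for k l
    unfolding exp_line_diff using assms(2)[OF that] by (intro countable_exp_in_qpowers assms(1)) auto
  then have "countable (\<Union>(k, l)\<in>P. {s. c * exp (line w v s $ k - line w v s $ l) \<in> qpowers q})"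
    by (intro countable_UN) auto
  also have "(\<Union>(k, l)\<in>P. {s. c * exp (line w v s $ k - line w v s $ l) \<in> qpowers q}) =
      {s. \<exists>(k, l)\<in>P. c * exp (line w v s $ k - line w v s $ l) \<in> qpowers q}"
    by (auto simp del: line_nth)
  finally show ?thesis .
qed

lemma countable_line_not_mem_Phi_dom:
  fixes w :: "complex ^ 'n::{finite,linorder}"
  assumes q: "0 < q" "q < 1"
    and "\<And>l. v l \<noteq> 0 \<or> b * exp (w $ l) \<notin> qpowers q"
    and "\<And>k l. k \<noteq> l \<Longrightarrow> v k \<noteq> v l \<or> of_real q powr \<tau> * exp (w $ k - w $ l) \<notin> qpowers q"
  shows "countable {s. line w v s \<notin> Phi_dom q \<tau> b}"
proof (rule countable_subset)
  let ?B1 = "{s. \<exists>l. b * exp (line w v s $ l) \<in> qpowers q}"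
  let ?B2 = "{s. \<exists>(k, l)\<in>{(k, l). k \<noteq> l}. of_real q powr \<tau> * exp (line w v s $ k - line w v s $ l) \<in> qpowers q}"
  show "{s. line w v s \<notin> Phi_dom q \<tau> b} \<subseteq> ?B1 \<union> ?B2"
  proof (rule subsetI, rule ccontr)
    fix s assume s: "s \<in> {s. line w v s \<notin> Phi_dom q \<tau> b}" "s \<notin> ?B1 \<union> ?B2"
    have "line w v s \<in> Phi_dom q \<tau> b"
      using s(2) by (intro mem_Phi_dom[OF q]) (auto simp del: line_nth)
    then show False using s(1) by simp
  qed
  show "countable (?B1 \<union> ?B2)"
    using assms by (intro countable_Un countable_line_coord countable_line_diff) auto
qed

text \<open>Off a countable set the line approaches w through the domain, and v l \<noteq> 0 keeps
  it away from w itself, so the limit over the domain restricts to the line.\<close>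

lemma Phi_eq_limit_on_line:
  fixes w :: "complex ^ 'n::{finite,linorder}"
  assumes "v l \<noteq> 0"
    and c: "(Phi_formula q \<alpha> \<tau> a b \<longlongrightarrow> c) (at w within Phi_dom q \<tau> b)"
    and "countable B" "{s. line w v s \<notin> Phi_dom q \<tau> b} \<subseteq> B"
  shows "((\<lambda>s. Phi_formula q \<alpha> \<tau> a b (line w v s)) \<longlongrightarrow> Phi q \<alpha> \<tau> a b w) (at 0 within - B)"
proof -
  have "eventually (\<lambda>s. line w v s \<in> Phi_dom q \<tau> b \<and> line w v s \<noteq> w) (at 0 within - B)"
    unfolding eventually_at_filter
  proof (intro always_eventually allI impI conjI)
    fix s assume s: "s \<noteq> 0" "s \<in> - B"
    then show "line w v s \<in> Phi_dom q \<tau> b" using assms(4) by blast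
    have "line w v s $ l \<noteq> w $ l" using s assms(1) by simp
    then show "line w v s \<noteq> w" by metis
  qed
  then have line: "filterlim (line w v) (at w within Phi_dom q \<tau> b) (at 0 within - B)"
    by (simp add: filterlim_at line_tendsto)
  \<comment> \<open>\<open>Lim\<close> returns c only if the filter is nontrivial; the image of a
    nontrivial filter along the line shows that it is.\<close>
  have "at w within Phi_dom q \<tau> b \<noteq> bot"
    using line at_within_co_countable_neq_bot[OF assms(3), of 0]
    by (auto simp: filterlim_def filtermap_bot_iff bot_unique)
  then have "Phi q \<alpha> \<tau> a b w = c"
    unfolding Phi_def using c by (rule tendsto_Lim)
  then show ?thesis
    using filterlim_compose[OF c line] by simp
qed

text \<open>Such a direction keeps z_i / z_j fixed while every coordinate and every other quotient
  moves.\<close>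

lemma ex_injective_direction:
  fixes i j :: "'n::finite"
  shows "\<exists>v :: 'n \<Rightarrow> real. (\<forall>l. v l \<noteq> 0) \<and> v i = v j \<and> (\<forall>k l. k \<noteq> l \<longrightarrow> {k, l} \<noteq> {i, j} \<longrightarrow> v k \<noteq> v l)"
proof -
  obtain f :: "'n \<Rightarrow> nat" where f: "inj f"
    using finite_imp_inj_to_nat_seg[OF finite, of "UNIV :: 'n set"] by auto
  show ?thesis
  proof (intro exI conjI allI impI)
    fix k l assume "k \<noteq> l" "{k, l} \<noteq> {i, j}"
    then have "(if k = j then i else k) \<noteq> (if l = j then i else l)" by (auto split: if_splits)
    \<comment> \<open>The witness: \<open>Suc\<close> makes all entries nonzero, and j is identified
      with i before the injection f is applied.\<close>
    then show "real (Suc (f (if k = j then i else k))) \<noteq> real (Suc (f (if l = j then i else l)))"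
      using f by (simp add: inj_eq)
  qed auto
qed

section \<open>The case t = q^-m with m \<ge> 0\<close>

text \<open>A limit would bound the formula K / D near w, giving |K| \<le> M |D|. Other factors may
  vanish or blow up at w, so the contradiction is drawn at a nearby w' on the divisor where D
  vanishes and K does not.\<close>

lemma no_limit_if_coords_eq:
  fixes w :: "complex ^ 'n::{finite,linorder}"
  assumes q: "0 < q" "q < 1" and "i < j" and "w $ i = w $ j"
    and t: "of_real q powr \<tau> = inverse (of_real q ^ m :: complex)"
    and c: "(Phi_formula q \<alpha> \<tau> a b \<longlongrightarrow> c) (at w within Phi_dom q \<tau> b)"
  shows False
proof -
  define T where "T = (of_real q :: complex) powr \<tau>"
  define M where "M = norm c + 1"
  have "eventually (\<lambda>y. norm (Phi_formula q \<alpha> \<tau> a b y) < M) (at w within Phi_dom q \<tau> b)"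
    using order_tendstoD(2)[OF tendsto_norm[OF c], of M] by (simp add: M_def)
  then obtain \<delta> where "\<delta> > 0"
    and \<delta>: "\<And>y. y \<in> Phi_dom q \<tau> b \<Longrightarrow> y \<noteq> w \<Longrightarrow> dist y w < \<delta> \<Longrightarrow> norm (Phi_formula q \<alpha> \<tau> a b y) < M"
    unfolding eventually_at by auto
  obtain v :: "'n \<Rightarrow> real" where v: "\<And>l. v l \<noteq> 0" "v i = v j"
    "\<And>k l. k \<noteq> l \<Longrightarrow> {k, l} \<noteq> {i, j} \<Longrightarrow> v k \<noteq> v l"
    using ex_injective_direction[of i j] by blast
  \<comment> \<open>Outside B no numerator or denominator vanishes in the coordinate factors or in
    the pair factors other than (i, j). That pair is left out because its quotient stays 1 along the
    line.\<close>
  define B where "B = {s. \<exists>l. b * exp (line w v s $ l) \<in> qpowers q} \<union>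
    {s. \<exists>l. of_real q * inverse a * exp (line w v s $ l) \<in> qpowers q} \<union>
    {s. \<exists>(k, l)\<in>{(k, l). k \<noteq> l \<and> {k, l} \<noteq> {i, j}}. T * exp (line w v s $ k - line w v s $ l) \<in> qpowers q}"
  have "countable B"
    unfolding B_def using v q by (intro countable_Un countable_line_coord countable_line_diff) auto
  moreover have "eventually (\<lambda>s. dist (line w v s) w < \<delta>) (at 0 within - B)"
    using tendstoD[OF line_tendsto \<open>\<delta> > 0\<close>] .
  moreover have "eventually (\<lambda>s. s \<noteq> 0 \<and> s \<notin> B) (at 0 within - B)"
    by (auto simp: eventually_at_filter)
  ultimately have "\<exists>s. dist (line w v s) w < \<delta> \<and> s \<noteq> 0 \<and> s \<notin> B"
    using eventually_happens'[OF at_within_co_countable_neq_bot eventually_conj] by blast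
  then obtain s where s: "dist (line w v s) w < \<delta>" "s \<noteq> 0" "s \<notin> B" by blast
  define w' where "w' = line w v s"
  have w'_b: "b * exp (w' $ l) \<notin> qpowers q" for l
    using s(3) by (auto simp: B_def w'_def)
  have w'_a: "of_real q * inverse a * exp (w' $ l) \<notin> qpowers q" for l
    using s(3) by (auto simp: B_def w'_def)
  have w'_t: "T * exp (w' $ k - w' $ l) \<notin> qpowers q" if "k \<noteq> l" "{k, l} \<noteq> {i, j}" for k l
    using s(3) that unfolding B_def w'_def by blast
  have w'_eq: "w' $ i = w' $ j"
    using \<open>w $ i = w $ j\<close> v(2) by (simp add: w'_def)
  \<comment> \<open>A second direction, transversal to the divisor: moving only the i-th coordinate,
    it reaches w' through the domain.\<close>
  define e where "e = (\<lambda>l. if l = i then 1 else 0 :: real)"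
  define y where "y = line w' e"
  define B' where "B' = {r. y r \<notin> Phi_dom q \<tau> b}"
  have "countable B'"
    unfolding B'_def y_def
  proof (rule countable_line_not_mem_Phi_dom[OF q])
    show "e l \<noteq> 0 \<or> b * exp (w' $ l) \<notin> qpowers q" for l
      using w'_b by blast
    show "e k \<noteq> e l \<or> of_real q powr \<tau> * exp (w' $ k - w' $ l) \<notin> qpowers q" if "k \<noteq> l" for k l
      using w'_t[OF that] that \<open>i < j\<close> by (cases "{k, l} = {i, j}") (auto simp: e_def T_def doubleton_eq_iff)
  qed
  then have nb: "at 0 within - B' \<noteq> bot"
    by (rule at_within_co_countable_neq_bot)
  have y_lim: "(y \<longlongrightarrow> w') (at 0 within - B')"
    unfolding y_def by (rule line_tendsto)
  define P where "P = {(k, l). k < l} - {(i, j)}"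
  have P: "k \<noteq> l" "{k, l} \<noteq> {i, j}" if "(k, l) \<in> P" for k l
    using that \<open>i < j\<close> by (auto simp: P_def doubleton_eq_iff)
  \<comment> \<open>D is the one denominator that vanishes at w'; K collects the rest and is
    continuous there.\<close>
  define D where "D = (\<lambda>z. qpoch_inf q (T * (exp (z $ j) / exp (z $ i))))"
  define K where "K = (\<lambda>z. (\<Prod>l\<in>UNIV. coord_factor q \<alpha> a b (z $ l)) * 
    (\<Prod>p\<in>P. pair_factor q \<tau> (z $ fst p) (z $ snd p)) *
    (exp ((2 * \<tau> - 1) * z $ i) * qpoch_inf q (of_real q * inverse T * (exp (z $ j) / exp (z $ i)))))"
  have F: "Phi_formula q \<alpha> \<tau> a b z = K z / D z" for z
  proof -
    have "(\<Prod>(k, l)\<in>{(k, l). k < l}. pair_factor q \<tau> (z $ k) (z $ l)) =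
        pair_factor q \<tau> (z $ i) (z $ j) * (\<Prod>p\<in>P. pair_factor q \<tau> (z $ fst p) (z $ snd p))"
      unfolding P_def using \<open>i < j\<close> by (subst prod.remove[of _ "(i, j)"]) (auto simp: case_prod_beta)
    then show ?thesis
      by (simp add: Phi_formula_factors K_def D_def T_def pair_factor_def[of q \<tau> "z $ i"])
  qed
  have "eventually (\<lambda>r. norm (K (y r)) \<le> M * norm (D (y r))) (at 0 within - B')"
  proof -
    have "eventually (\<lambda>r. y r \<in> Phi_dom q \<tau> b) (at 0 within - B')"
      by (auto simp: eventually_at_filter B'_def)
    moreover have "eventually (\<lambda>r. dist (y r) w < \<delta>) (at 0 within - B')"
      using order_tendstoD(2)[OF tendsto_dist[OF y_lim tendsto_const]] s(1) by (simp add: w'_def)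
    ultimately show ?thesis
    proof eventually_elim
      case (elim r)
      \<comment> \<open>The bound \<delta> excludes w itself; e fixes the j-th coordinate, in which
        w' already differs from w.\<close>
      have "y r $ j \<noteq> w $ j"
        using \<open>i < j\<close> s(2) v(1) by (simp add: y_def e_def w'_def)
      then have "norm (Phi_formula q \<alpha> \<tau> a b (y r)) < M"
        using \<delta> elim by metis
      moreover have "D (y r) \<noteq> 0"
        using elim(1) \<open>i < j\<close> by (auto simp: Phi_dom_def D_def T_def)
      ultimately show ?case
        by (simp add: F norm_divide field_simps)
    qed
  qed
  moreover have "((\<lambda>r. M * norm (D (y r))) \<longlongrightarrow> M * norm (D w')) (at 0 within - B')"
    unfolding D_def by (intro tendsto_intros tendsto_vec_nth y_lim tendsto_qpoch_inf[OF q]) simp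
  moreover have "((\<lambda>r. norm (K (y r))) \<longlongrightarrow> norm (K w')) (at 0 within - B')"
    unfolding K_def coord_factor_def pair_factor_def
  proof (intro tendsto_intros tendsto_vec_nth y_lim tendsto_qpoch_inf[OF q])
    show "qpoch_inf q (b * exp (w' $ l)) \<noteq> 0" for l
      using w'_b qpoch_inf_nonzero[OF q] by blast
    show "qpoch_inf q (of_real q powr \<tau> * (exp (w' $ snd p) / exp (w' $ fst p))) \<noteq> 0" if "p \<in> P" for p
      using w'_t[of "snd p" "fst p"] P[of "fst p" "snd p"] that qpoch_inf_nonzero[OF q]
      by (simp add: exp_diff T_def insert_commute)
  qed auto
  ultimately have "norm (K w') \<le> M * norm (D w')"
    using tendsto_le[OF nb] by blast
  also have "D w' = 0"
    using w'_eq t qpoch_inf_eq_0[OF q] by (simp add: D_def T_def)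
  finally have "K w' = 0" by simp
  moreover have "K w' \<noteq> 0"
  proof -
    have "coord_factor q \<alpha> a b (w' $ l) \<noteq> 0" for l
      using w'_a w'_b qpoch_inf_nonzero[OF q] by (simp add: coord_factor_def)
    moreover have "pair_factor q \<tau> (w' $ fst p) (w' $ snd p) \<noteq> 0" if "p \<in> P" for p
      using w'_t[of "snd p" "fst p"] w'_t[of "fst p" "snd p"] P[of "fst p" "snd p"] that
      by (intro pair_factor_nonzero[OF q]) (auto simp: T_def insert_commute)
    \<comment> \<open>Here q / T = q^(m+1) lies in \<open>qpowers q\<close>, so
      \<open>qpoch_inf_nonzero\<close> does not apply; but every exponent n + m + 1 is positive, so
      no factor vanishes.\<close>
    moreover have "qpoch_inf q (of_real q * inverse T) \<noteq> 0"
    proof (rule qpoch_inf_nonzero_if_factors_nonzero[OF q])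
      fix n
      have "q ^ (n + Suc m) < 1"
        using q power_Suc_less_one[of q "n + m"] by simp
      moreover have "of_real q ^ n * (of_real q * inverse T) = of_real (q ^ (n + Suc m))"
        using t by (simp add: T_def power_add)
      ultimately show "of_real q ^ n * (of_real q * inverse T) \<noteq> 1"
        by (metis of_real_eq_1_iff less_irrefl)
    qed
    ultimately show ?thesis
      using w'_eq by (simp add: K_def)
  qed
  ultimately show False by contradiction
qed

section \<open>Symmetry of \<Phi> at points with z_i / z_j a power of q\<close>

lemma Phi_swap_coords:
  fixes w :: "complex ^ 'n::{finite,linorder}"
  assumes q: "0 < q" "q < 1" and "i < j"
    and N: "w $ i = w $ j + of_int N * of_real (ln q)"
    and t: "of_real q powr \<tau> \<notin> qpowers q"
    and c: "(Phi_formula q \<alpha> \<tau> a b \<longlongrightarrow> c) (at w within Phi_dom q \<tau> b)"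
    and c': "(Phi_formula q \<alpha> \<tau> a b \<longlongrightarrow> c') (at (swap_coords i j w) within Phi_dom q \<tau> b)"
  shows "Phi q \<alpha> \<tau> a b (swap_coords i j w) = Phi q \<alpha> \<tau> a b w"
proof -
  obtain v :: "'n \<Rightarrow> real" where v: "\<And>l. v l \<noteq> 0" "v i = v j"
    "\<And>k l. k \<noteq> l \<Longrightarrow> {k, l} \<noteq> {i, j} \<Longrightarrow> v k \<noteq> v l"
    using ex_injective_direction[of i j] by blast
  define T where "T = (of_real q :: complex) powr \<tau>"
  define B where "B = {s. \<exists>l. b * exp (line w v s $ l) \<in> qpowers q} \<union>
    {s. \<exists>(k, l)\<in>{(k, l). k \<noteq> l}. T * exp (line w v s $ k - line w v s $ l) \<in> qpowers q}"
  \<comment> \<open>This quotient does not move along the line, but it is a power of q, so t outside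
    \<open>qpowers q\<close> already makes it generic.\<close>
  have "T * exp (w $ k - w $ l) \<notin> qpowers q" if kl: "{k, l} = {i, j}" "k \<noteq> l" for k l
  proof -
    obtain n where "w $ k - w $ l = of_int n * of_real (ln q)"
    proof (cases "k = i")
      case True
      then have "l = j" using kl by (auto simp: doubleton_eq_iff)
      then show ?thesis using that[of N] True N by simp
    next
      case False
      then have "k = j" "l = i" using kl by (auto simp: doubleton_eq_iff)
      then show ?thesis using that[of "-N"] N by simp
    qed
    then have eq: "T * exp (w $ k - w $ l) = of_real q powi n * T"
      using exp_int_mult_ln[OF q(1)] by simp
    show ?thesis
      unfolding eq qpowers_mult_iff[OF q(1) powi_in_qpowers] using t by (simp add: T_def)
  qed
  then have "v k \<noteq> v l \<or> T * exp (w $ k - w $ l) \<notin> qpowers q" if "k \<noteq> l" for k l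
    using v(3) that by blast
  then have B: "countable B"
    unfolding B_def using v(1) q by (intro countable_Un countable_line_coord countable_line_diff) auto
  have good: "b * exp (line w v s $ l) \<notin> qpowers q"
    "k \<noteq> l \<Longrightarrow> T * exp (line w v s $ k - line w v s $ l) \<notin> qpowers q" if "s \<notin> B" for s k l
    using that by (auto simp: B_def)
  \<comment> \<open>By v i = v j, swapping commutes with moving along the line, so one exceptional
    set B serves both limits.\<close>
  have line_swap: "line (swap_coords i j w) v s = swap_coords i j (line w v s)" for s
    using v(2) by (auto simp: vec_eq_iff Transposition.transpose_def)
  have "{s. line w v s \<notin> Phi_dom q \<tau> b} \<subseteq> B"
  proof (rule subsetI, rule ccontr)
    fix s assume "s \<in> {s. line w v s \<notin> Phi_dom q \<tau> b}" "s \<notin> B"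
    moreover have "line w v s \<in> Phi_dom q \<tau> b"
      by (rule mem_Phi_dom[OF q good(1)[OF \<open>s \<notin> B\<close>] good(2)[OF \<open>s \<notin> B\<close>, unfolded T_def]])
    ultimately show False by simp
  qed
  then have lim: "((\<lambda>s. Phi_formula q \<alpha> \<tau> a b (line w v s)) \<longlongrightarrow> Phi q \<alpha> \<tau> a b w) (at 0 within - B)"
    by (rule Phi_eq_limit_on_line[OF v(1) c B])
  have "{s. line (swap_coords i j w) v s \<notin> Phi_dom q \<tau> b} \<subseteq> B"
  proof (rule subsetI, rule ccontr)
    fix s assume "s \<in> {s. line (swap_coords i j w) v s \<notin> Phi_dom q \<tau> b}" "s \<notin> B"
    moreover have "swap_coords i j (line w v s) \<in> Phi_dom q \<tau> b"
    proof (rule mem_Phi_dom[OF q])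
      fix k l :: 'n assume "k \<noteq> l"
      then have "Transposition.transpose i j k \<noteq> Transposition.transpose i j l"
        by (metis transpose_involutory)
      then show "of_real q powr \<tau> * exp (swap_coords i j (line w v s) $ k - swap_coords i j (line w v s) $ l) \<notin> qpowers q"
        unfolding swap_coords_nth T_def[symmetric] by (rule good(2)[OF \<open>s \<notin> B\<close>])
    qed (use good(1)[OF \<open>s \<notin> B\<close>] in \<open>simp del: line_nth\<close>)
    ultimately show False by (simp add: line_swap)
  qed
  then have lim': "((\<lambda>s. Phi_formula q \<alpha> \<tau> a b (line (swap_coords i j w) v s)) \<longlongrightarrow>
      Phi q \<alpha> \<tau> a b (swap_coords i j w)) (at 0 within - B)"
    by (rule Phi_eq_limit_on_line[OF v(1) c' B])
  \<comment> \<open>Since v i = v j, the i-th and j-th coordinates keep the difference N ln q along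
    the line, so the symmetry of the formula applies outside B.\<close>
  have "eventually (\<lambda>s. Phi_formula q \<alpha> \<tau> a b (line (swap_coords i j w) v s) =
      Phi_formula q \<alpha> \<tau> a b (line w v s)) (at 0 within - B)"
    unfolding eventually_at_filter
  proof (intro always_eventually allI impI)
    fix s assume "s \<in> - B"
    then show "Phi_formula q \<alpha> \<tau> a b (line (swap_coords i j w) v s) = Phi_formula q \<alpha> \<tau> a b (line w v s)"
      unfolding line_swap
      using good(2)[of s] N v(2) by (intro Phi_formula_swap_coords[OF q \<open>i < j\<close> _ _ t]) (auto simp: T_def)
  qed
  then have "((\<lambda>s. Phi_formula q \<alpha> \<tau> a b (line w v s)) \<longlongrightarrow> Phi q \<alpha> \<tau> a b (swap_coords i j w)) (at 0 within - B)"
    using lim' tendsto_cong by fast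
  then show ?thesis
    using tendsto_unique[OF at_within_co_countable_neq_bot[OF B]] lim by blast
qed

section \<open>Vanishing of the antisymmetric lattice sum\<close>

theorem lemma3p1:
  fixes q :: real
    and \<alpha> \<tau> t a\<^sub>1 b\<^sub>1 :: complex
    and x L :: "complex ^ 'n::{finite,linorder}"
    and i j :: 'n
  assumes "0 < q" "q < 1"
    and "a\<^sub>1 \<noteq> 0" "b\<^sub>1 \<noteq> 0"
    and "t = of_real q powr \<tau>"
    and "\<forall>l\<in>{1..CARD('n)}.
           norm (of_real q * inverse a\<^sub>1 * inverse b\<^sub>1) < norm (of_real q powr \<alpha> * t ^ (2 * l - 2)) \<and>
           norm (of_real q powr \<alpha> * t ^ (2 * l - 2)) < 1"
    and "\<forall>m::nat. 1 \<le> m \<longrightarrow> t \<noteq> of_real q ^ m"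
    and "\<forall>k. x $ k \<noteq> 0"
    and "\<forall>k. exp (L $ k) = x $ k"
    and "\<forall>k l. x $ k = x $ l \<longrightarrow> L $ k = L $ l"
    and "\<forall>\<nu>. \<not> Phi_pole q \<alpha> \<tau> a\<^sub>1 b\<^sub>1 (lattice_point q x \<nu>)"
    and "i < j" "x $ i = x $ j"
  shows "jackson_I q \<alpha> \<tau> a\<^sub>1 b\<^sub>1 L x = 0"
proof -
  note q = assms(1,2)
  have L_eq: "L $ i = L $ j" using assms(10,13) by blast
  have exp_log: "exp (lattice_log q L \<nu> $ k) = lattice_point q x \<nu> $ k" for \<nu> k
    using assms(9) by (simp add: lattice_log_def lattice_point_def exp_add exp_int_mult_ln[OF q(1)])
  have limit: "\<exists>c. (Phi_formula q \<alpha> \<tau> a\<^sub>1 b\<^sub>1 \<longlongrightarrow> c) (at (lattice_log q L \<nu>) within Phi_dom q \<tau> b\<^sub>1)" for \<nu>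
    using assms(11) exp_log[of \<nu>] unfolding Phi_pole_def by blast
  have t: "of_real q powr \<tau> \<notin> qpowers q"
  proof
    assume "of_real q powr \<tau> \<in> qpowers q"
    then obtain m where m: "of_real q powr \<tau> = (of_real q powi m :: complex)"
      by (auto simp: qpowers_def)
    have "\<not> m > 0"
    proof
      assume "m > 0"
      then have "t = of_real q ^ nat m" "1 \<le> nat m"
        using m assms(5) by (simp_all add: power_int_def)
      then show False using assms(7) by blast
    qed
    \<comment> \<open>For m \<le> 0 the lattice point with \<nu> = 0, which is x itself, would be a
      pole.\<close>
    then have "of_real q powr \<tau> = inverse (of_real q ^ nat (- m) :: complex)"
      using m by (auto simp: power_int_def power_inverse)
    moreover obtain c where "(Phi_formula q \<alpha> \<tau> a\<^sub>1 b\<^sub>1 \<longlongrightarrow> c) (at (lattice_log q L 0) within Phi_dom q \<tau> b\<^sub>1)"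
      using limit by blast
    moreover have "lattice_log q L 0 $ i = lattice_log q L 0 $ j"
      using L_eq by (simp add: lattice_log_def)
    ultimately show False
      using no_limit_if_coords_eq[OF q assms(12)] by blast
  qed
  let ?f = "\<lambda>\<nu>. Phi q \<alpha> \<tau> a\<^sub>1 b\<^sub>1 (lattice_log q L \<nu>) * Delta (lattice_point q x \<nu>)"
  have anti: "?f (swap_coords i j \<nu>) = - ?f \<nu>" for \<nu>
  proof -
    \<comment> \<open>Because L $ i = L $ j, swapping the exponents \<nu> swaps the chosen
      logarithms, and with them the branches of the powers.\<close>
    have log: "lattice_log q L (swap_coords i j \<nu>) = swap_coords i j (lattice_log q L \<nu>)"
      using L_eq by (auto simp: vec_eq_iff lattice_log_def Transposition.transpose_def)
    have point: "lattice_point q x (swap_coords i j \<nu>) = swap_coords i j (lattice_point q x \<nu>)"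
      using assms(13) by (auto simp: vec_eq_iff lattice_point_def Transposition.transpose_def)
    obtain c c' where "(Phi_formula q \<alpha> \<tau> a\<^sub>1 b\<^sub>1 \<longlongrightarrow> c) (at (lattice_log q L \<nu>) within Phi_dom q \<tau> b\<^sub>1)"
      "(Phi_formula q \<alpha> \<tau> a\<^sub>1 b\<^sub>1 \<longlongrightarrow> c') (at (swap_coords i j (lattice_log q L \<nu>)) within Phi_dom q \<tau> b\<^sub>1)"
      using limit[of \<nu>] limit[of "swap_coords i j \<nu>"] unfolding log by blast
    moreover have "lattice_log q L \<nu> $ i = lattice_log q L \<nu> $ j + of_int (\<nu> $ i - \<nu> $ j) * of_real (ln q)"
      using L_eq by (simp add: lattice_log_def algebra_simps)
    ultimately have "Phi q \<alpha> \<tau> a\<^sub>1 b\<^sub>1 (swap_coords i j (lattice_log q L \<nu>)) = Phi q \<alpha> \<tau> a\<^sub>1 b\<^sub>1 (lattice_log q L \<nu>)"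
      using Phi_swap_coords[OF q assms(12) _ t] by blast
    then show ?thesis
      unfolding log point using Delta_swap_coords[OF assms(12)] by simp
  qed
  have "swap_coords i j (swap_coords i j \<nu>) = \<nu>" for \<nu> :: "int ^ 'n::{finite,linorder}"
    by (simp add: vec_eq_iff)
  then have "bij (swap_coords i j :: int ^ 'n::{finite,linorder} \<Rightarrow> int ^ 'n::{finite,linorder})"
    by (intro o_bij[of "swap_coords i j"]) auto
  \<comment> \<open>\<open>infsum\<close> takes the value 0 on families that are not summable;
    reindexing and negation both respect this convention, so the sum equals its own
    negative.\<close>
  then have "infsum ?f UNIV = infsum (\<lambda>\<nu>. ?f (swap_coords i j \<nu>)) UNIV"
    by (rule infsum_reindex_bij_betw[symmetric])
  also have "\<dots> = - infsum ?f UNIV"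
    by (simp only: anti infsum_uminus)
  finally have "infsum ?f UNIV = 0" by simp
  then show ?thesis by (simp add: jackson_I_def)
qed

end
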